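(* Assume that $1\le q<p<\infty$, that $X$ supports a $q$-Poincaré inequality at $x_0$, and that $\mu$ has, for some $\eta>0$, the $\eta$-annular decay property at $x_0$ and is reverse-doubling at $x_0$ with dilation $\tau>1$. Then there is a constant $c>0$, independent of $r$ and $R$, such that $$\operatorname{cap}_p(B_r,B_R)\ge c\Bigl(1-\frac{r}{R}\Bigr)^{\eta(q-p)/q}\frac{\mu(B_R)}{R^p}\qquad\text{whenever } 0<\frac R2\le r<R\le\frac{\operatorname{diam}X}{2\tau}.$$
   Context: $X=(X,d,\mu)$ is a metric space equipped with a metric $d$ and a positive complete Borel measure $\mu$ such that $0<\mu(B)<\infty$ for all balls $B\subset X$. Write $B(x,r)=\{y\in X: d(y,x)<r\}$; $x_0\in X$ is a fixed but arbitrary point and $B_r=B(x_0,r)$. For a ball $B=B(x,r)$ and $\lambda>0$, $\lambda B=B(x,\lambda r)$. Annular decay: $\mu$ has the $\eta$-annular decay property at $x$ if there is a constant $C$ such that $\mu(B(x,R)\setminus B(x,r))\le C(1-r/R)^\eta\mu(B(x,R))$ for all radii $0<r<R$. Reverse-doubling: $\mu$ is reverse-doubling at $x$ with dilation $\tau>1$ if there is $\gamma>1$ such that $\mu(B(x,\tau r))\ge\gamma\mu(B(x,r))$ for all $0<r\le\operatorname{diam}X/(2\tau)$. Upper gradients and Newtonian space: curves are nonconstant, compact and rectifiable, parameterized by arc length $ds$. A Borel function $g:X\to[0,\infty]$ is an upper gradient of $f:X\to[-\infty,\infty]$ if for all curves $\gamma:[0,l_\gamma]\to X$, $|f(\gamma(0))-f(\gamma(l_\gamma))|\le\int_\gamma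 g\,ds$, where the left-hand side is considered to be $\infty$ whenever at least one of the terms therein is infinite. A measurable $g:X\to[0,\infty]$ is a $p$-weak upper gradient of $f$ if this inequality holds for $p$-almost every curve, i.e. except for a family $\Gamma$ of curves for which there is $0\le\rho\in L^p(X)$ with $\int_\gamma\rho\,ds=\infty$ for all $\gamma\in\Gamma$. If $f$ has an upper gradient in $L^p(X)$, then $g_f$ denotes its (a.e. unique) minimal $p$-weak upper gradient in $L^p(X)$, i.e. $g_f\le g$ a.e. for every $p$-weak upper gradient $g\in L^p(X)$ of $f$. $N^{1,p}(X)$ is the space of measurable functions $f:X\to[-\infty,\infty]$ (defined everywhere) with $\|f\|_{N^{1,p}(X)}=\bigl(\int_X|f|^p\,d\mu+\inf_g\int_X g^p\,d\mu\bigr)^{1/p}<\infty$, the infimum being over all upper gradients $g$ of $f$. Poincaré inequality: $X$ supports a $q$-Poincaré inequality at $x$ if there are constants $C>0$ and $\lambda\ge1$ such that for all balls $B=B(x,r)$, $r>0$, all integrable functions $f$ on $X$ and all upper gradients $g$ of $f$, $\frac1{\mu(B)}\int_B|f-f_B|\,d\mu\le Cr\bigl(\frac1{\mu(\lambda B)}\int_{\lambda B}g^q\,d\mu\bigr)^{1/q}$, where $f_B=\frac1{\mu(B)}\int_Bf\,d\mu$. Variational capacity: for $\Omega\subset X$ open and $E\subset\Omega$, $\operatorname{cap}_p(E,\Omega)=\inf_u\int_\Omega g_u^p\,d\mu$, the infimum being over all $u\in N^{1,p}(X)$ with $\chi_E\le u\le1$ in $\Omega$ and $u=0$ on $X\setminus\Omega$.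 *)

theory Defs
  imports "HOL-Analysis.Analysis"
begin

text \<open>The metric space X is a type of class \<open>metric_space\<close>; balls are the open balls
  \<^term>\<open>ball x r\<close> with \<open>r > 0\<close>. Functions into \<open>[0, \<infinity>]\<close> are \<^typ>\<open>ennreal\<close>-valued,
  functions into \<open>[-\<infinity>, \<infinity>]\<close> are \<^typ>\<open>ereal\<close>-valued.\<close>

text \<open>A complete Borel measure is the completion of a measure on the Borel sigma-algebra.\<close>

definition metric_measure_space :: "'a::metric_space measure \<Rightarrow> bool" where
  "metric_measure_space M \<longleftrightarrow>
     (\<exists>N. sets N = sets borel \<and> M = completion N) \<and>
     (\<forall>x r. 0 < r \<longrightarrow> 0 < emeasure M (ball x r) \<and> emeasure M (ball x r) < \<infinity>)"

text \<open>The library's \<^const>\<open>diameter\<close> is real-valued and unspecified on unbounded sets.\<close>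

definition ediameter :: "'a::metric_space set \<Rightarrow> ennreal" where
  "ediameter S = (SUP (x, y)\<in>S \<times> S. ennreal (dist x y))"

text \<open>Only used for exponents \<open>a > 0\<close>.\<close>

definition epowr :: "ennreal \<Rightarrow> real \<Rightarrow> ennreal" where
  "epowr x a = (if x = \<infinity> then \<infinity> else ennreal (enn2real x powr a))"


subsection \<open>Conditions on the measure at a point\<close>

definition annular_decay_at :: "'a::metric_space measure \<Rightarrow> real \<Rightarrow> 'a \<Rightarrow> bool" where
  "annular_decay_at M \<eta> x \<longleftrightarrow>
     (\<exists>C. \<forall>r R. 0 < r \<and> r < R \<longrightarrow>
        measure M (ball x R - ball x r) \<le> C * (1 - r / R) powr \<eta> * measure M (ball x R))"

definition reverse_doubling_at :: "'a::metric_space measure \<Rightarrow> real \<Rightarrow> 'a \<Rightarrow> bool" where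
  "reverse_doubling_at M \<tau> x \<longleftrightarrow>
     (\<exists>\<gamma>>1. \<forall>r. 0 < r \<and> ennreal r \<le> ediameter (UNIV :: 'a set) / ennreal (2 * \<tau>) \<longrightarrow>
        measure M (ball x (\<tau> * r)) \<ge> \<gamma> * measure M (ball x r))"


subsection \<open>Curves and upper gradients\<close>

definition curve_length :: "(real \<Rightarrow> 'a::metric_space) \<Rightarrow> real \<Rightarrow> real \<Rightarrow> ennreal" where
  "curve_length \<gamma> a b =
     (SUP ts\<in>{ts. sorted ts \<and> set ts \<subseteq> {a..b}}.
        \<Sum>i<length ts - 1. ennreal (dist (\<gamma> (ts ! i)) (\<gamma> (ts ! Suc i))))"

text \<open>Nonconstant compact rectifiable curves parameterized by arc length on \<open>[0, l]\<close>:
  the condition makes \<open>\<gamma>\<close> 1-Lipschitz on \<open>[0, l]\<close>, and it is nonconstant since \<open>l > 0\<close>.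
  Values of \<open>\<gamma>\<close> outside \<open>[0, l]\<close> are irrelevant.\<close>

definition arclength_curve :: "real \<Rightarrow> (real \<Rightarrow> 'a::metric_space) \<Rightarrow> bool" where
  "arclength_curve l \<gamma> \<longleftrightarrow>
     0 < l \<and> (\<forall>s t. 0 \<le> s \<and> s \<le> t \<and> t \<le> l \<longrightarrow> curve_length \<gamma> s t = ennreal (t - s))"

definition line_integral :: "real \<Rightarrow> (real \<Rightarrow> 'a) \<Rightarrow> ('a \<Rightarrow> ennreal) \<Rightarrow> ennreal" where
  "line_integral l \<gamma> g = (\<integral>\<^sup>+ t\<in>{0..l}. g (\<gamma> t) \<partial>lebesgue)"

definition endpoint_diff :: "ereal \<Rightarrow> ereal \<Rightarrow> ennreal" where
  "endpoint_diff a b = (if \<bar>a\<bar> = \<infinity> \<or> \<bar>b\<bar> = \<infinity> then \<infinity> else e2ennreal \<bar>a - b\<bar>)"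

definition upper_gradient :: "('a::metric_space \<Rightarrow> ereal) \<Rightarrow> ('a \<Rightarrow> ennreal) \<Rightarrow> bool" where
  "upper_gradient f g \<longleftrightarrow> g \<in> borel_measurable borel \<and>
     (\<forall>l \<gamma>. arclength_curve l \<gamma> \<longrightarrow>
        endpoint_diff (f (\<gamma> 0)) (f (\<gamma> l)) \<le> line_integral l \<gamma> g)"

definition Lp_nonneg :: "'a measure \<Rightarrow> real \<Rightarrow> ('a \<Rightarrow> ennreal) set" where
  "Lp_nonneg M p = {g \<in> borel_measurable M. (\<integral>\<^sup>+ x. epowr (g x) p \<partial>M) < \<infinity>}"

definition p_almost_every_curve ::
  "'a::metric_space measure \<Rightarrow> real \<Rightarrow> (real \<Rightarrow> (real \<Rightarrow> 'a) \<Rightarrow> bool) \<Rightarrow> bool" where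
  "p_almost_every_curve M p P \<longleftrightarrow>
     (\<exists>\<rho>\<in>Lp_nonneg M p. \<forall>l \<gamma>. arclength_curve l \<gamma> \<and> \<not> P l \<gamma> \<longrightarrow> line_integral l \<gamma> \<rho> = \<infinity>)"

definition weak_upper_gradient ::
  "'a::metric_space measure \<Rightarrow> real \<Rightarrow> ('a \<Rightarrow> ereal) \<Rightarrow> ('a \<Rightarrow> ennreal) \<Rightarrow> bool" where
  "weak_upper_gradient M p f g \<longleftrightarrow> g \<in> borel_measurable M \<and>
     p_almost_every_curve M p
       (\<lambda>l \<gamma>. endpoint_diff (f (\<gamma> 0)) (f (\<gamma> l)) \<le> line_integral l \<gamma> g)"

text \<open>The minimal p-weak upper gradient is unique only up to a.e. equality, so it is
  described by a predicate: \<open>g\<close> is a representative of the minimal one.\<close>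

definition minimal_weak_upper_gradient ::
  "'a::metric_space measure \<Rightarrow> real \<Rightarrow> ('a \<Rightarrow> ereal) \<Rightarrow> ('a \<Rightarrow> ennreal) \<Rightarrow> bool" where
  "minimal_weak_upper_gradient M p f g \<longleftrightarrow>
     g \<in> Lp_nonneg M p \<and> weak_upper_gradient M p f g \<and>
     (\<forall>h\<in>Lp_nonneg M p. weak_upper_gradient M p f h \<longrightarrow> (AE x in M. g x \<le> h x))"

definition newtonian_norm :: "'a::metric_space measure \<Rightarrow> real \<Rightarrow> ('a \<Rightarrow> ereal) \<Rightarrow> ennreal" where
  "newtonian_norm M p f =
     epowr ((\<integral>\<^sup>+ x. epowr (e2ennreal \<bar>f x\<bar>) p \<partial>M) +
            (INF g\<in>{g. upper_gradient f g}. \<integral>\<^sup>+ x. epowr (g x) p \<partial>M)) (1 / p)"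

definition newtonian_space :: "'a::metric_space measure \<Rightarrow> real \<Rightarrow> ('a \<Rightarrow> ereal) set" where
  "newtonian_space M p = {f \<in> borel_measurable M. newtonian_norm M p f < \<infinity>}"


subsection \<open>Poincare inequality and capacity\<close>

text \<open>Integrable extended real-valued functions are finite a.e., so \<^const>\<open>real_of_ereal\<close>
  does not affect the mean value.\<close>

definition mean_value :: "'a measure \<Rightarrow> 'a set \<Rightarrow> ('a \<Rightarrow> ereal) \<Rightarrow> real" where
  "mean_value M B f = (LINT x:B|M. real_of_ereal (f x)) / measure M B"

definition poincare_at :: "'a::metric_space measure \<Rightarrow> real \<Rightarrow> 'a \<Rightarrow> bool" where
  "poincare_at M q x \<longleftrightarrow>
     (\<exists>C>0. \<exists>\<Lambda>\<ge>1. \<forall>r>0. \<forall>f g.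
        f \<in> borel_measurable M \<and> (\<integral>\<^sup>+ y. e2ennreal \<bar>f y\<bar> \<partial>M) < \<infinity> \<and> upper_gradient f g \<longrightarrow>
        (\<integral>\<^sup>+ y\<in>ball x r. e2ennreal \<bar>f y - ereal (mean_value M (ball x r) f)\<bar> \<partial>M)
            / emeasure M (ball x r)
        \<le> ennreal (C * r) *
           epowr ((\<integral>\<^sup>+ y\<in>ball x (\<Lambda> * r). epowr (g y) q \<partial>M) / emeasure M (ball x (\<Lambda> * r))) (1 / q))"

definition cap_admissible ::
  "'a::metric_space measure \<Rightarrow> real \<Rightarrow> 'a set \<Rightarrow> 'a set \<Rightarrow> ('a \<Rightarrow> ereal) set" where
  "cap_admissible M p E \<Omega> =
     {u \<in> newtonian_space M p.
        (\<forall>x\<in>\<Omega>. indicator E x \<le> u x \<and> u x \<le> 1) \<and> (\<forall>x\<in>-\<Omega>. u x = 0)}"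

text \<open>The capacity is meant for open \<open>\<Omega>\<close> and \<open>E \<subseteq> \<Omega>\<close>. All representatives \<open>g\<close> of the minimal
  p-weak upper gradient of \<open>u\<close> have the same integral.\<close>

definition variational_capacity ::
  "'a::metric_space measure \<Rightarrow> real \<Rightarrow> 'a set \<Rightarrow> 'a set \<Rightarrow> ennreal" where
  "variational_capacity M p E \<Omega> =
     (INF (u, g)\<in>{(u, g). u \<in> cap_admissible M p E \<Omega> \<and> minimal_weak_upper_gradient M p u g}.
        \<integral>\<^sup>+ x\<in>\<Omega>. epowr (g x) p \<partial>M)"

end

theory Submission
  imports Defs
begin

text \<open>Let \<open>u\<close> be admissible for the capacity and \<open>W\<close> the annulus \<open>B\<^sub>R - B\<^sub>r\<close>.
  The Poincare inequality on \<open>\<tau>B\<^sub>R\<close> bounds the \<open>q\<close>-energy of \<open>u\<close> from below by a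
  multiple of \<open>\<mu>(B\<^sub>R) / R\<^sup>q\<close>, because \<open>u = 1\<close> on \<open>B\<^sub>r\<close>, which has comparable measure by
  annular decay, and \<open>u = 0\<close> on \<open>\<tau>B\<^sub>R - B\<^sub>R\<close>, which has comparable measure by reverse
  doubling. As \<open>u\<close> is constant on \<open>B\<^sub>r\<close> and outside \<open>B\<^sub>R\<close>, only the gradient on \<open>W\<close>
  counts. The pointwise bound \<open>g\<^sup>q \<le> t\<^sup>q + t\<^bsup>q-p\<^esup> g\<^sup>p\<close>, integrated over \<open>W\<close> with a
  suitable \<open>t\<close>, replaces the Hoelder inequality, and annular decay bounds \<open>\<mu>(W)\<close>.\<close>

section \<open>Powers of extended reals and curves\<close>

lemma epowr_mono: "x \<le> y \<Longrightarrow> 0 \<le> a \<Longrightarrow> epowr x a \<le> epowr y a"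
  by (auto simp: epowr_def top_unique less_top intro!: ennreal_leI powr_mono2 enn2real_mono)

lemma epowr_measurable [measurable]: "(\<lambda>x. epowr x a) \<in> borel_measurable borel"
  unfolding epowr_def by measurable

lemma epowr_ennreal: "0 \<le> x \<Longrightarrow> epowr (ennreal x) a = ennreal (x powr a)"
  by (simp add: epowr_def)

lemma epowr_cmult:
  assumes "0 < c" shows "epowr (ennreal c * x) a = ennreal (c powr a) * epowr x a"
  using assms
  by (cases x) (auto simp: epowr_def ennreal_mult_top powr_mult enn2real_mult simp flip: ennreal_mult)

text \<open>The sum is at most twice the larger summand. The resulting constant is crude but serves
  every exponent \<open>a \<ge> 0\<close>, below and above 1 alike.\<close>

lemma epowr_add_le:
  assumes "0 \<le> a"
  shows "epowr (x + y) a \<le> ennreal (2 powr a) * (epowr x a + epowr y a)"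
proof -
  have "x + y \<le> ennreal 2 * max x y"
    by (metis add_mono ennreal_numeral max.cobounded1 max.cobounded2 mult_2 zero_le_numeral)
  then have "epowr (x + y) a \<le> epowr (ennreal 2 * max x y) a"
    using assms by (rule epowr_mono)
  also have "\<dots> = ennreal (2 powr a) * epowr (max x y) a"
    by (simp add: epowr_cmult del: ennreal_numeral)
  also have "epowr (max x y) a \<le> epowr x a + epowr y a"
    by (simp add: max_def add_increasing add_increasing2)
  finally show ?thesis by (simp add: mult_left_mono)
qed

text \<open>Up to the level \<open>t\<close> the first term alone suffices. Above it the second one
  does: \<open>q - p\<close> is nonpositive, so a value \<open>s > t\<close> satisfies
  \<open>s powr (q - p) \<le> t powr (q - p)\<close>. The level stays free, to balance the two terms
  later.\<close>

lemma epowr_le_truncation: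
  assumes "0 < t" "0 \<le> q" "q \<le> p"
  shows "epowr x q \<le> ennreal (t powr q) + ennreal (t powr (q - p)) * epowr x p"
proof (cases x)
  case (real s)
  have "s powr q \<le> t powr q + t powr (q - p) * s powr p"
  proof (cases "s \<le> t")
    case True
    then show ?thesis using real assms by (intro add_increasing2) (auto intro: powr_mono2)
  next
    case False
    have "s powr q = s powr (q - p) * s powr p" using False assms by (simp flip: powr_add)
    also have "\<dots> \<le> t powr (q - p) * s powr p"
      using False assms by (intro mult_right_mono powr_mono2') auto
    finally show ?thesis by (simp add: add_increasing)
  qed
  then show ?thesis using real by (simp add: epowr_ennreal ennreal_leI flip: ennreal_mult ennreal_plus)
next
  case top
  then show ?thesis using assms by (simp add: epowr_def ennreal_mult_top)
qed

text \<open>Altering a function on a null set may change its integral along a curve that runs inside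
  that set. A Borel representative that dominates \<open>f\<close> everywhere can only increase line
  integrals, so upper gradient inequalities survive on every curve.\<close>

lemma borel_measurable_completion_majorant:
  fixes f :: "'a \<Rightarrow> ennreal"
  assumes f: "f \<in> borel_measurable (completion N)"
  obtains g where "g \<in> borel_measurable N" "\<And>x. f x \<le> g x" "AE x in completion N. f x = g x"
proof -
  obtain h where h: "h \<in> borel_measurable N" "AE x in N. f x = h x"
    using completion_ex_borel_measurable[OF f] by blast
  obtain Z where Z: "{x\<in>space N. f x \<noteq> h x} \<subseteq> Z" "Z \<in> null_sets N"
    using h(2) by (auto elim!: AE_E)
  show ?thesis
  proof
    \<comment> \<open>The null set \<open>Z\<close> contains every point of the space where
      \<open>h\<close> differs from \<open>f\<close>; the value \<infinity> there turns
      \<open>h\<close> into a majorant.\<close>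
    let ?g = "\<lambda>x. if x \<in> Z \<or> x \<notin> space N then \<infinity> else h x"
    show "?g \<in> borel_measurable N" using h Z by (measurable, auto)
    show "f x \<le> ?g x" for x using Z by auto
    have "AE x in N. f x = ?g x"
      using h(2) AE_not_in[OF Z(2)] AE_space by eventually_elim auto
    then show "AE x in completion N. f x = ?g x" by (rule AE_completion)
  qed
qed

section \<open>Subcurves and line integrals\<close>

lemma curve_length_shift:
  "curve_length (\<lambda>t. \<gamma> (c + t)) a b = curve_length \<gamma> (c + a) (c + b)"
proof -
  have im: "{ts. sorted ts \<and> set ts \<subseteq> {c + a..c + b}} = map ((+) c) ` {ts. sorted ts \<and> set ts \<subseteq> {a..b}}"
    (is "?L = ?R")
  proof (intro subset_antisym subsetI)
    fix ts assume "ts \<in> ?L"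
    moreover have "ts = map ((+) c) (map (\<lambda>t. t - c) ts)" by (simp add: comp_def)
    ultimately show "ts \<in> ?R" 
      by (intro image_eqI[where x = "map (\<lambda>t. t - c) ts"]) (auto simp: sorted_map intro: sorted_wrt_mono_rel)
  next
    fix ts assume "ts \<in> ?R"
    then show "ts \<in> ?L" by (fastforce simp: sorted_map intro: sorted_wrt_mono_rel)
  qed
  show ?thesis unfolding curve_length_def im image_image
    by (intro SUP_cong refl) simp
qed

lemma arclength_curve_subcurve:
  assumes "arclength_curve l \<gamma>" "0 \<le> a" "a < b" "b \<le> l"
  shows "arclength_curve (b - a) (\<lambda>t. \<gamma> (a + t))"
  using assms unfolding arclength_curve_def by (auto simp: curve_length_shift)

lemma dist_le_curve_length:
  assumes "s \<le> t" shows "ennreal (dist (\<gamma> s) (\<gamma> t)) \<le> curve_length \<gamma> s t"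
  unfolding curve_length_def using assms by (intro SUP_upper2[where i = "[s, t]"]) auto

lemma arclength_curve_continuous:
  assumes "arclength_curve l \<gamma>" shows "continuous_on {0..l} \<gamma>"
proof -
  have le: "dist (\<gamma> s) (\<gamma> t) \<le> t - s" if "0 \<le> s" "s \<le> t" "t \<le> l" for s t
    using that assms dist_le_curve_length[of s t \<gamma>] by (auto simp: arclength_curve_def)
  have "1-lipschitz_on {0..l} \<gamma>"
  proof (rule lipschitz_onI)
    fix s t assume "s \<in> {0..l}" "t \<in> {0..l}"
    then show "dist (\<gamma> s) (\<gamma> t) \<le> 1 * dist s t"
      using le[of s t] le[of t s] by (cases "s \<le> t") (auto simp: dist_real_def dist_commute)
  qed simp
  then show ?thesis by (rule lipschitz_on_continuous_on)
qed

text \<open>The values of \<open>\<gamma>\<close> outside \<open>{0..l}\<close> are arbitrary, so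
  measurability comes from continuity on the parameter interval and is extended to the line by the
  indicator.\<close>

lemma arclength_curve_measurable:
  fixes g :: "'a::metric_space \<Rightarrow> ennreal"
  assumes "arclength_curve l \<gamma>" "g \<in> borel_measurable borel"
  shows "(\<lambda>t. g (\<gamma> t) * indicator {0..l} t) \<in> borel_measurable borel"
proof -
  have "\<gamma> \<in> borel_measurable (restrict_space borel {0..l})"
    using arclength_curve_continuous[OF assms(1)] by (rule borel_measurable_continuous_on_restrict)
  then have "(\<lambda>t. g (\<gamma> t)) \<in> borel_measurable (restrict_space borel {0..l})"
    using assms(2) by measurable
  then show ?thesis by (subst (asm) borel_measurable_restrict_space_iff_ennreal) auto
qed

text \<open>Translation of the parameter by \<open>a\<close>. The indicator of \<open>{0..l}\<close>
  is 1 on \<open>{a..b}\<close>; carrying it along lets all subcurves share one integrand that is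
  Borel on the whole line.\<close>

lemma line_integral_subcurve:
  assumes \<gamma>: "arclength_curve l \<gamma>" and g: "g \<in> borel_measurable borel"
    and ab: "0 \<le> a" "a < b" "b \<le> l"
  shows "line_integral (b - a) (\<lambda>t. \<gamma> (a + t)) g
       = (\<integral>\<^sup>+ t\<in>{a..b}. (g (\<gamma> t) * indicator {0..l} t) \<partial>lborel)"
proof -
  note [measurable] = arclength_curve_measurable[OF \<gamma> g]
  have "(\<integral>\<^sup>+ t\<in>{a..b}. (g (\<gamma> t) * indicator {0..l} t) \<partial>lborel)
    = (\<integral>\<^sup>+ t. (g (\<gamma> (a + t)) * indicator {0..l} (a + t)) * indicator {a..b} (a + t) \<partial>lborel)"
    by (subst nn_integral_real_affine[where c = 1 and t = a]) auto
  also have "\<dots> = (\<integral>\<^sup>+ t\<in>{0..b - a}. g (\<gamma> (a + t)) \<partial>lborel)"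
    using ab by (intro nn_integral_cong) (auto simp: indicator_def)
  finally show ?thesis unfolding line_integral_def by (simp add: nn_integral_completion)
qed

section \<open>Removing the gradient on level sets\<close>

text \<open>The indicators of \<open>{X n..Y n}\<close> converge pointwise to that of
  \<open>{a..b}\<close>, and \<open>F\<close> is an integrable majorant, so dominated convergence
  carries the bound to the limit.\<close>

lemma le_nn_integral_shrinking_intervals:
  fixes F :: "real \<Rightarrow> ennreal"
  assumes F [measurable]: "F \<in> borel_measurable borel" and fin: "(\<integral>\<^sup>+ t. F t \<partial>lborel) < \<infinity>"
    and lim: "X \<longlonglongrightarrow> a" "Y \<longlonglongrightarrow> b" and X: "\<And>n. X n \<le> a" and Y: "\<And>n. b \<le> Y n"
    and le: "\<And>n. A \<le> (\<integral>\<^sup>+ t\<in>{X n..Y n}. F t \<partial>lborel)"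
  shows "A \<le> (\<integral>\<^sup>+ t\<in>{a<..<b}. F t \<partial>lborel)"
proof -
  have ptw: "(\<lambda>n. F t * indicator {X n..Y n} t) \<longlonglongrightarrow> F t * indicator {a..b} t" for t
  proof (cases "t \<in> {a..b}")
    case True
    then have "t \<in> {X n..Y n}" for n using X[of n] Y[of n] by auto
    then show ?thesis using True by (simp add: indicator_def)
  next
    case False
    then have "\<forall>\<^sub>F n in sequentially. t < X n \<or> Y n < t"
      using order_tendstoD(1)[OF lim(1), of t] order_tendstoD(2)[OF lim(2), of t]
      by (auto elim: eventually_mono)
    then have "\<forall>\<^sub>F n in sequentially. F t * indicator {X n..Y n} t = F t * indicator {a..b} t"
      by eventually_elim (use False in \<open>auto simp: indicator_def\<close>)
    then show ?thesis by (rule tendsto_eventually)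
  qed
  have "(\<lambda>n. \<integral>\<^sup>+ t\<in>{X n..Y n}. F t \<partial>lborel) \<longlonglongrightarrow> (\<integral>\<^sup>+ t\<in>{a..b}. F t \<partial>lborel)"
    by (rule nn_integral_dominated_convergence[where w = F])
      (use ptw fin in \<open>auto simp: indicator_def\<close>)
  then have "A \<le> (\<integral>\<^sup>+ t\<in>{a..b}. F t \<partial>lborel)"
    using le by (intro LIMSEQ_le_const) auto
  \<comment> \<open>Endpoints are Lebesgue null. Open intervals matter later, since a first or last
    visit to a level set may itself belong to the set.\<close>
  also have "\<dots> = (\<integral>\<^sup>+ t\<in>{a<..<b}. F t \<partial>lborel)"
    using AE_lborel_singleton[of a] AE_lborel_singleton[of b]
    by (intro nn_integral_cong_AE) (auto elim!: eventually_elim2 simp: indicator_def)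
  finally show ?thesis .
qed

text \<open>Cut the curve at its first and its last visit to \<open>S\<close>. Finiteness of the integral is needed
  because these visits may be attained only in the limit.\<close>

lemma dist_le_nn_integral_off_level_set:
  fixes F :: "real \<Rightarrow> ennreal" and v :: "real \<Rightarrow> 'b::metric_space"
  assumes F [measurable]: "F \<in> borel_measurable borel" and fin: "(\<integral>\<^sup>+ t. F t \<partial>lborel) < \<infinity>"
    and "a < b"
    and H: "\<And>s t. a \<le> s \<Longrightarrow> s < t \<Longrightarrow> t \<le> b \<Longrightarrow>
              ennreal (dist (v s) (v t)) \<le> (\<integral>\<^sup>+ x\<in>{s..t}. F x \<partial>lborel)"
    and S: "\<And>s. s \<in> S \<Longrightarrow> v s = c"
  shows "ennreal (dist (v a) (v b)) \<le> (\<integral>\<^sup>+ x\<in>{a..b}. F x * indicator (- S) x \<partial>lborel)"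
proof (cases "S \<inter> {a..b} = {}")
  case True
  have "ennreal (dist (v a) (v b)) \<le> (\<integral>\<^sup>+ x\<in>{a..b}. F x \<partial>lborel)"
    using H \<open>a < b\<close> by simp
  also have "\<dots> = (\<integral>\<^sup>+ x\<in>{a..b}. F x * indicator (- S) x \<partial>lborel)"
    using True by (intro nn_integral_cong) (auto simp: indicator_def)
  finally show ?thesis .
next
  case False
  let ?T = "S \<inter> {a..b}"
  have H': "ennreal (dist (v s) (v t)) \<le> (\<integral>\<^sup>+ x\<in>{s..t}. F x \<partial>lborel)"
    if "a \<le> s" "s \<le> t" "t \<le> b" for s t
    using H[of s t] that by (cases "s = t") auto
  have bdd: "bdd_below ?T" "bdd_above ?T" by (auto intro: bdd_belowI bdd_aboveI)
  have le: "Inf ?T \<le> t" "t \<le> Sup ?T" if "t \<in> ?T" for t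
    using that bdd by (auto intro: cInf_lower cSup_upper)
  \<comment> \<open>No continuity of \<open>v\<close> is assumed, so its value at the infimum of
    \<open>?T\<close> is unknown. Visits converging to the infimum are used instead, where
    \<open>v\<close> equals \<open>c\<close>.\<close>
  obtain X where X: "\<And>n. X n \<in> ?T" "X \<longlonglongrightarrow> Inf ?T"
    using closure_contains_Inf[OF False bdd(1)] unfolding closure_sequential by blast
  obtain Y where Y: "\<And>n. Y n \<in> ?T" "Y \<longlonglongrightarrow> Sup ?T"
    using closure_contains_Sup[OF False bdd(2)] unfolding closure_sequential by blast
  have first: "ennreal (dist (v a) c) \<le> (\<integral>\<^sup>+ x\<in>{a<..<Inf ?T}. F x \<partial>lborel)"
  proof (rule le_nn_integral_shrinking_intervals[OF F fin tendsto_const X(2)])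
    show "ennreal (dist (v a) c) \<le> (\<integral>\<^sup>+ x\<in>{a..X n}. F x \<partial>lborel)" for n
      using H'[of a "X n"] X(1)[of n] S by auto
  qed (use X le in auto)
  have last: "ennreal (dist c (v b)) \<le> (\<integral>\<^sup>+ x\<in>{Sup ?T<..<b}. F x \<partial>lborel)"
  proof (rule le_nn_integral_shrinking_intervals[OF F fin Y(2) tendsto_const])
    show "ennreal (dist c (v b)) \<le> (\<integral>\<^sup>+ x\<in>{Y n..b}. F x \<partial>lborel)" for n
      using H'[of "Y n" b] Y(1)[of n] S by auto
  qed (use Y le in auto)
  \<comment> \<open>This makes the two open intervals disjoint, so that their indicators add up to
    at most 1.\<close>
  have "Inf ?T \<le> Sup ?T" using False le by fastforce
  have off: "x \<notin> S" if "x \<in> {a<..<Inf ?T} \<union> {Sup ?T<..<b}" for x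
  proof
    assume "x \<in> S"
    moreover have "a \<le> Sup ?T" "Inf ?T \<le> b"
      using False le by (fastforce intro: order_trans)+
    ultimately have "x \<in> ?T" using that by auto
    then show False using le[of x] that by auto
  qed
  have "ennreal (dist (v a) (v b)) \<le> ennreal (dist (v a) c) + ennreal (dist c (v b))"
    by (simp add: ennreal_leI dist_triangle flip: ennreal_plus)
  also have "\<dots> \<le> (\<integral>\<^sup>+ x\<in>{a<..<Inf ?T}. F x \<partial>lborel) + (\<integral>\<^sup>+ x\<in>{Sup ?T<..<b}. F x \<partial>lborel)"
    using first last by (rule add_mono)
  also have "\<dots> = (\<integral>\<^sup>+ x. F x * indicator {a<..<Inf ?T} x + F x * indicator {Sup ?T<..<b} x \<partial>lborel)"
    by (subst nn_integral_add) auto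
  also have "\<dots> \<le> (\<integral>\<^sup>+ x\<in>{a..b}. F x * indicator (- S) x \<partial>lborel)"
  proof (rule nn_integral_mono)
    fix x
    have "a \<le> Sup ?T" "Inf ?T \<le> b"
      using False le by (fastforce intro: order_trans)+
    then show "F x * indicator {a<..<Inf ?T} x + F x * indicator {Sup ?T<..<b} x
        \<le> F x * indicator (- S) x * indicator {a..b} x"
      using off[of x] \<open>Inf ?T \<le> Sup ?T\<close> by (auto simp: indicator_def)
  qed
  finally show ?thesis .
qed

text \<open>A pointwise majorant \<open>\<sigma>\<close> of \<open>g\<close> and of the function witnessing the exceptional family absorbs,
  with an arbitrarily small coefficient, all curves on which the argument by subcurves fails.\<close>

lemma upper_gradient_off_level_sets:
  fixes w :: "'a::metric_space \<Rightarrow> real" and g \<sigma> :: "'a \<Rightarrow> ennreal"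
  assumes g [measurable]: "g \<in> borel_measurable borel" and \<sigma> [measurable]: "\<sigma> \<in> borel_measurable borel"
    and g_le: "\<And>x. g x \<le> \<sigma> x"
    and weak: "\<And>l \<gamma>. arclength_curve l \<gamma> \<Longrightarrow> line_integral l \<gamma> \<sigma> < \<infinity> \<Longrightarrow>
           ennreal (dist (w (\<gamma> 0)) (w (\<gamma> l))) \<le> line_integral l \<gamma> g"
    and U: "U \<in> sets borel" "\<And>x. x \<in> U \<Longrightarrow> w x = c"
    and V: "V \<in> sets borel" "\<And>x. x \<in> V \<Longrightarrow> w x = d"
    and "0 < \<epsilon>"
  shows "upper_gradient (\<lambda>x. ereal (w x)) (\<lambda>x. g x * indicator (- (U \<union> V)) x + ennreal \<epsilon> * \<sigma> x)"
  unfolding upper_gradient_def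
proof (intro conjI allI impI)
  note [measurable] = U(1) V(1)
  show "(\<lambda>x. g x * indicator (- (U \<union> V)) x + ennreal \<epsilon> * \<sigma> x) \<in> borel_measurable borel"
    by measurable
  fix l and \<gamma> :: "real \<Rightarrow> 'a" assume \<gamma>: "arclength_curve l \<gamma>"
  then have "0 < l" by (simp add: arclength_curve_def)
  let ?k = "\<lambda>x. g x * indicator (- (U \<union> V)) x + ennreal \<epsilon> * \<sigma> x"
  have diff: "endpoint_diff (ereal (w (\<gamma> 0))) (ereal (w (\<gamma> l))) = ennreal (dist (w (\<gamma> 0)) (w (\<gamma> l)))"
    by (simp add: endpoint_diff_def dist_real_def)
  have li: "line_integral l \<gamma> h = (\<integral>\<^sup>+ t. h (\<gamma> t) * indicator {0..l} t \<partial>lborel)" for h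
    by (simp add: line_integral_def nn_integral_completion)
  show "endpoint_diff (ereal (w (\<gamma> 0))) (ereal (w (\<gamma> l))) \<le> line_integral l \<gamma> ?k"
  proof (cases "line_integral l \<gamma> \<sigma> < \<infinity>")
    case False
    note [measurable] = arclength_curve_measurable[OF \<gamma> \<sigma>]
    \<comment> \<open>On these curves the term with \<open>\<epsilon>\<close> alone is already
      infinite.\<close>
    have "\<infinity> = ennreal \<epsilon> * line_integral l \<gamma> \<sigma>"
      using False \<open>0 < \<epsilon>\<close> by (simp add: less_top[symmetric] ennreal_mult_top)
    also have "\<dots> = (\<integral>\<^sup>+ t. ennreal \<epsilon> * (\<sigma> (\<gamma> t) * indicator {0..l} t) \<partial>lborel)"
      unfolding li by (rule nn_integral_cmult[symmetric]) simp
    also have "\<dots> \<le> line_integral l \<gamma> ?k"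
      unfolding li by (intro nn_integral_mono) (auto simp: indicator_def)
    finally show ?thesis by (simp add: top_unique)
  next
    case True
    have sub: "line_integral (b - a) (\<lambda>t. \<gamma> (a + t)) h
        = (\<integral>\<^sup>+ t\<in>{a..b}. (h (\<gamma> t) * indicator {0..l} t) \<partial>lborel)"
      if "h \<in> borel_measurable borel" "0 \<le> a" "a < b" "b \<le> l" for h a b
      using line_integral_subcurve[OF \<gamma> that] .
    have fin: "(\<integral>\<^sup>+ t. h (\<gamma> t) * indicator {0..l} t \<partial>lborel) < \<infinity>"
      if "\<And>x. h x \<le> \<sigma> x" for h
      using True that unfolding li
      by (elim le_less_trans[rotated]) (auto intro!: nn_integral_mono mult_right_mono)
    \<comment> \<open>The hypothesis \<open>weak\<close> speaks of whole curves. It applies to each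
      subcurve because the integral of \<open>\<sigma>\<close> over a subcurve is finite as
      well.\<close>
    have A: "ennreal (dist (w (\<gamma> a)) (w (\<gamma> b)))
        \<le> (\<integral>\<^sup>+ t\<in>{a..b}. (g (\<gamma> t) * indicator {0..l} t) \<partial>lborel)"
      if "0 \<le> a" "a < b" "b \<le> l" for a b
    proof -
      have "line_integral (b - a) (\<lambda>t. \<gamma> (a + t)) \<sigma> \<le> line_integral l \<gamma> \<sigma>"
        unfolding sub[OF \<sigma> that] li by (intro nn_integral_mono) (auto simp: indicator_def)
      then show ?thesis
        using weak[OF arclength_curve_subcurve[OF \<gamma> that]] True sub[OF g that] by auto
    qed
    \<comment> \<open>Removing \<open>U\<close> on every subinterval, and not only on
      \<open>{0..l}\<close>, reproduces the hypothesis of the level set lemma, which can then be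
      applied once more to remove \<open>V\<close>.\<close>
    have B: "ennreal (dist (w (\<gamma> a)) (w (\<gamma> b))) \<le> (\<integral>\<^sup>+ t\<in>{a..b}.
        ((g (\<gamma> t) * indicator (- U) (\<gamma> t)) * indicator {0..l} t) \<partial>lborel)"
      if "0 \<le> a" "a < b" "b \<le> l" for a b
    proof -
      have "ennreal (dist (w (\<gamma> a)) (w (\<gamma> b))) \<le> (\<integral>\<^sup>+ t\<in>{a..b}.
          (g (\<gamma> t) * indicator {0..l} t) * indicator (- (\<gamma> -` U)) t \<partial>lborel)"
        by (rule dist_le_nn_integral_off_level_set[where v = "\<lambda>t. w (\<gamma> t)" and c = c])
          (use that A U fin[OF g_le] arclength_curve_measurable[OF \<gamma> g] in auto)
      then show ?thesis by (simp add: ac_simps indicator_def cong: if_cong)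
    qed
    have "ennreal (dist (w (\<gamma> 0)) (w (\<gamma> l))) \<le> (\<integral>\<^sup>+ t\<in>{0..l}.
        ((g (\<gamma> t) * indicator (- U) (\<gamma> t)) * indicator {0..l} t) * indicator (- (\<gamma> -` V)) t \<partial>lborel)"
    proof (rule dist_le_nn_integral_off_level_set[where v = "\<lambda>t. w (\<gamma> t)" and c = d])
      show "(\<lambda>t. g (\<gamma> t) * indicator (- U) (\<gamma> t) * indicator {0..l} t) \<in> borel_measurable borel"
        by (rule arclength_curve_measurable[OF \<gamma>, where g = "\<lambda>x. g x * indicator (- U) x"]) measurable
      show "(\<integral>\<^sup>+ t. g (\<gamma> t) * indicator (- U) (\<gamma> t) * indicator {0..l} t \<partial>lborel) < \<infinity>"
        by (rule fin[where h = "\<lambda>x. g x * indicator (- U) x"]) (use g_le in \<open>auto simp: indicator_def\<close>)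
    qed (use B V \<open>0 < l\<close> in auto)
    also have "\<dots> \<le> line_integral l \<gamma> ?k"
      unfolding li by (intro nn_integral_mono) (auto simp: indicator_def)
    finally show ?thesis unfolding diff .
  qed
qed

section \<open>Energy bound from the Poincare inequality\<close>

lemma metric_measure_space_sets:
  assumes "metric_measure_space M"
  shows "sets borel \<subseteq> sets M" "space M = UNIV"
proof -
  obtain N where N: "sets N = sets borel" "M = completion N"
    using assms unfolding metric_measure_space_def by blast
  then show "sets borel \<subseteq> sets M" by (auto simp: sets_completion)
  show "space M = UNIV" using N sets_eq_imp_space_eq[OF N(1)] by simp
qed

lemma ball_measure:
  assumes "metric_measure_space M"
  shows "ball x r \<in> sets M" "emeasure M (ball x r) = ennreal (measure M (ball x r))"
    "0 < r \<Longrightarrow> 0 < measure M (ball x r)" "emeasure M (ball x r) \<noteq> \<infinity>"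
proof -
  show "ball x r \<in> sets M"
    using metric_measure_space_sets[OF assms] by (auto intro: borel_open)
  have fin: "0 < r \<Longrightarrow> 0 < emeasure M (ball x r) \<and> emeasure M (ball x r) < \<infinity>"
    using assms unfolding metric_measure_space_def by blast
  show "emeasure M (ball x r) \<noteq> \<infinity>" using fin by (cases "0 < r") (auto simp: ball_empty)
  then show "emeasure M (ball x r) = ennreal (measure M (ball x r))"
    by (simp add: emeasure_eq_ennreal_measure)
  with fin show "0 < r \<Longrightarrow> 0 < measure M (ball x r)" by (auto simp: ennreal_zero_less_mult_iff)
qed

lemma measure_annulus:
  assumes "metric_measure_space M" "r \<le> R"
  shows "measure M (ball x R - ball x r) = measure M (ball x R) - measure M (ball x r)"
  using assms ball_measure[OF assms(1)]
  by (intro measure_Diff) (auto intro: subset_ball)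

lemma measure_ball_mono:
  assumes "metric_measure_space M" "r \<le> R"
  shows "measure M (ball x r) \<le> measure M (ball x R)"
  using measure_annulus[OF assms, of x] measure_nonneg[of M "ball x R - ball x r"] by linarith

text \<open>Enlarging the constant keeps the bound. The normalization \<open>1 \<le> C\<close>
  allows division by \<open>C\<close> and keeps the relative width of the annuli in the doubling
  argument below 1.\<close>

lemma annular_decay_atE:
  assumes "annular_decay_at M \<eta> x"
  obtains C where "1 \<le> C"
    "\<And>r R. 0 < r \<Longrightarrow> r < R \<Longrightarrow>
       measure M (ball x R - ball x r) \<le> C * (1 - r / R) powr \<eta> * measure M (ball x R)"
proof -
  obtain C where C: "\<And>r R. 0 < r \<Longrightarrow> r < R \<Longrightarrow>
       measure M (ball x R - ball x r) \<le> C * (1 - r / R) powr \<eta> * measure M (ball x R)"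
    using assms unfolding annular_decay_at_def by blast
  show ?thesis
  proof
    show "1 \<le> max C 1" by simp
    fix r R :: real assume "0 < r" "r < R"
    then have "measure M (ball x R - ball x r) \<le> C * (1 - r / R) powr \<eta> * measure M (ball x R)"
      by (rule C)
    also have "\<dots> \<le> max C 1 * (1 - r / R) powr \<eta> * measure M (ball x R)"
      by (intro mult_right_mono) auto
    finally show "measure M (ball x R - ball x r) \<le> \<dots>" .
  qed
qed

text \<open>Shrinking the radius by a factor \<open>1 - e\<close> loses at most half of the mass
  once \<open>C * e powr \<eta> = 1 / 2\<close>. After \<open>n\<close> such steps the radius is
  below \<open>\<kappa> * R\<close> and at least the fraction \<open>(1 / 2) ^ n\<close> of the mass
  is left.\<close>

lemma annular_decay_doubling:
  assumes M: "metric_measure_space M" and "0 < \<eta>" and ann: "annular_decay_at M \<eta> x" and "0 < \<kappa>"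
  obtains \<delta> where "0 < \<delta>"
    "\<And>R. 0 < R \<Longrightarrow> \<delta> * measure M (ball x R) \<le> measure M (ball x (\<kappa> * R))"
proof -
  obtain C where C: "1 \<le> C" "\<And>r R. 0 < r \<Longrightarrow> r < R \<Longrightarrow>
       measure M (ball x R - ball x r) \<le> C * (1 - r / R) powr \<eta> * measure M (ball x R)"
    using annular_decay_atE[OF ann] by blast
  define e where "e = (1 / (2 * C)) powr (1 / \<eta>)"
  have e: "0 < e" "C * e powr \<eta> = 1 / 2" using C(1) \<open>0 < \<eta>\<close> by (simp_all add: e_def powr_powr)
  have "e < 1 powr (1 / \<eta>)"
    unfolding e_def using C(1) \<open>0 < \<eta>\<close> by (intro powr_less_mono2) auto
  then have "e < 1" by simp
  have step: "1 / 2 * measure M (ball x R) \<le> measure M (ball x ((1 - e) * R))" if "0 < R" for R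
  proof -
    have "(1 - e) * R < R" "0 < (1 - e) * R" using that e \<open>e < 1\<close> by (auto simp: algebra_simps)
    from C(2)[OF this(2,1)] measure_annulus[OF M, of "(1 - e) * R" R x] this
    show ?thesis using that e by simp
  qed
  have iter: "(1 / 2) ^ n * measure M (ball x R) \<le> measure M (ball x ((1 - e) ^ n * R))"
    if "0 < R" for n R
  proof (induction n)
    case (Suc n)
    have "(1 / 2) ^ Suc n * measure M (ball x R) \<le> 1 / 2 * measure M (ball x ((1 - e) ^ n * R))"
      using Suc by simp
    also have "\<dots> \<le> measure M (ball x ((1 - e) * ((1 - e) ^ n * R)))"
      using step[of "(1 - e) ^ n * R"] that \<open>e < 1\<close> by simp
    finally show ?case by (simp add: mult.assoc)
  qed simp
  obtain n where n: "(1 - e) ^ n < \<kappa>"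
    using real_arch_pow_inv[of \<kappa> "1 - e"] \<open>0 < \<kappa>\<close> e by auto
  show ?thesis
  proof
    show "(0::real) < (1 / 2) ^ n" by simp
    fix R :: real assume "0 < R"
    then have "measure M (ball x ((1 - e) ^ n * R)) \<le> measure M (ball x (\<kappa> * R))"
      using n by (intro measure_ball_mono[OF M]) auto
    then show "(1 / 2) ^ n * measure M (ball x R) \<le> measure M (ball x (\<kappa> * R))"
      using iter[OF \<open>0 < R\<close>, of n] by linarith
  qed
qed

text \<open>By the triangle inequality \<open>1 \<le> \<bar>1 - m\<bar> + \<bar>m\<bar>\<close>: no
  constant \<open>m\<close>, in particular no mean value, is close to both 0 and 1.\<close>

lemma set_nn_integral_deviation_ge:
  fixes w :: "'a \<Rightarrow> real"
  assumes AB: "A \<in> sets M" "B \<in> sets M" "A \<inter> B = {}" "A \<subseteq> D" "B \<subseteq> D"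
    and w: "\<And>x. x \<in> A \<Longrightarrow> w x = 1" "\<And>x. x \<in> B \<Longrightarrow> w x = 0"
    and a: "a \<le> emeasure M A" "a \<le> emeasure M B"
  shows "a \<le> (\<integral>\<^sup>+ x\<in>D. ennreal \<bar>w x - m\<bar> \<partial>M)"
proof -
  have "a = ennreal 1 * a" by simp
  also have "\<dots> \<le> ennreal (\<bar>1 - m\<bar> + \<bar>m\<bar>) * a" by (intro mult_right_mono ennreal_leI) auto
  also have "\<dots> \<le> ennreal \<bar>1 - m\<bar> * emeasure M A + ennreal \<bar>m\<bar> * emeasure M B"
    using a by (subst ennreal_plus) (auto simp: distrib_right intro!: add_mono mult_left_mono)
  also have "\<dots> = (\<integral>\<^sup>+ x. ennreal \<bar>1 - m\<bar> * indicator A x + ennreal \<bar>m\<bar> * indicator B x \<partial>M)"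
    using AB by (subst nn_integral_add) (auto simp: nn_integral_cmult_indicator)
  also have "\<dots> \<le> (\<integral>\<^sup>+ x\<in>D. ennreal \<bar>w x - m\<bar> \<partial>M)"
    using AB w by (intro nn_integral_mono) (auto simp: indicator_def)
  finally show ?thesis .
qed

text \<open>On the ball of radius \<open>\<tau> * R\<close> the mean oscillation of \<open>w\<close>
  is at least a fixed \<open>\<beta>\<close>. The Poincare inequality then bounds the mean of
  \<open>k\<close> to the power \<open>q\<close> from below; multiplying by the measure of the
  dilated ball, which is at least that of \<open>ball x R\<close>, gives the claim.\<close>

lemma poincare_energy_lower_bound:
  fixes M :: "'a::metric_space measure"
  assumes M: "metric_measure_space M" and "1 \<le> q" and P: "poincare_at M q x"
    and "0 < \<eta>" and ann: "annular_decay_at M \<eta> x"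
    and "1 < \<tau>" and rd: "reverse_doubling_at M \<tau> x"
  obtains K \<Lambda> where "0 < K" "1 \<le> \<Lambda>"
    "\<And>r R w k. \<lbrakk>0 < R; R / 2 \<le> r; r < R; ennreal R \<le> ediameter (UNIV :: 'a set) / ennreal (2 * \<tau>);
       w \<in> borel_measurable M; \<forall>y. 0 \<le> w y \<and> w y \<le> 1; \<forall>y\<in>ball x r. w y = 1;
       \<forall>y\<in>-ball x R. w y = 0; upper_gradient (\<lambda>y. ereal (w y)) k\<rbrakk> \<Longrightarrow>
       ennreal (K * measure M (ball x R) / R powr q) \<le> (\<integral>\<^sup>+ y\<in>ball x (\<Lambda> * R). epowr (k y) q \<partial>M)"
proof -
  obtain C \<Lambda> where C: "0 < C" "1 \<le> \<Lambda>" and P: "\<And>r f g. \<lbrakk>0 < r; f \<in> borel_measurable M;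
        (\<integral>\<^sup>+ y. e2ennreal \<bar>f y\<bar> \<partial>M) < \<infinity>; upper_gradient f g\<rbrakk> \<Longrightarrow>
        (\<integral>\<^sup>+ y\<in>ball x r. e2ennreal \<bar>f y - ereal (mean_value M (ball x r) f)\<bar> \<partial>M)
            / emeasure M (ball x r)
        \<le> ennreal (C * r) *
           epowr ((\<integral>\<^sup>+ y\<in>ball x (\<Lambda> * r). epowr (g y) q \<partial>M) / emeasure M (ball x (\<Lambda> * r))) (1 / q)"
    using P unfolding poincare_at_def by blast
  obtain \<gamma> where \<gamma>: "1 < \<gamma>" "\<And>r. 0 < r \<Longrightarrow> ennreal r \<le> ediameter (UNIV :: 'a set) / ennreal (2 * \<tau>) \<Longrightarrow>
        \<gamma> * measure M (ball x r) \<le> measure M (ball x (\<tau> * r))"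
    using rd unfolding reverse_doubling_at_def by blast
  \<comment> \<open>This ratio leads from the radius \<open>\<tau> * R\<close> to
    \<open>R / 2\<close>, hence into \<open>ball x r\<close>.\<close>
  have "0 < 1 / (2 * \<tau>)" using \<open>1 < \<tau>\<close> by simp
  then obtain \<delta> where \<delta>: "0 < \<delta>"
    "\<And>R. 0 < R \<Longrightarrow> \<delta> * measure M (ball x R) \<le> measure M (ball x (1 / (2 * \<tau>) * R))"
    using annular_decay_doubling[OF M \<open>0 < \<eta>\<close> ann] by metis
  \<comment> \<open>A fraction of the ball of radius \<open>\<tau> * R\<close> that is guaranteed
    both to \<open>ball x r\<close>, through \<open>\<delta>\<close>, and to the part outside
    \<open>ball x R\<close>, through \<open>\<gamma>\<close>.\<close>
  define \<beta> where "\<beta> = min \<delta> (1 - 1 / \<gamma>)"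
  have "0 < \<beta>" using \<delta> \<gamma>(1) by (simp add: \<beta>_def)
  note bm = ball_measure[OF M]
  show ?thesis
  proof
    \<comment> \<open>This choice of \<open>K\<close> results from solving
      \<open>\<beta> \<le> C * \<tau> * R * (I / n) powr (1 / q)\<close> for
      \<open>I\<close>.\<close>
    show "0 < (\<beta> / (C * \<tau>)) powr q" using \<open>0 < \<beta>\<close> C \<open>1 < \<tau>\<close> by simp
    show "1 \<le> \<Lambda> * \<tau>" using C \<open>1 < \<tau>\<close> by (simp add: mult_ge1_I)
  next
    fix r R and w :: "'a \<Rightarrow> real" and k
    assume R: "0 < R" "R / 2 \<le> r" "r < R" "ennreal R \<le> ediameter (UNIV :: 'a set) / ennreal (2 * \<tau>)"
      and wM: "w \<in> borel_measurable M" and bounds: "\<forall>y. 0 \<le> w y \<and> w y \<le> 1" "\<forall>y\<in>ball x r. w y = 1"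
        "\<forall>y\<in>-ball x R. w y = 0" and k: "upper_gradient (\<lambda>y. ereal (w y)) k"
    have w: "0 \<le> w y" "w y \<le> 1" "y \<in> ball x r \<Longrightarrow> w y = 1" "y \<notin> ball x R \<Longrightarrow> w y = 0" for y
      using bounds by blast+
    let ?D = "ball x (\<tau> * R)"
    have "0 < \<tau> * R" "R < \<tau> * R" using R \<open>1 < \<tau>\<close> by auto
    define m where "m = mean_value M ?D (\<lambda>y. ereal (w y))"
    define I where "I = (\<integral>\<^sup>+ y\<in>ball x (\<Lambda> * \<tau> * R). epowr (k y) q \<partial>M)"
    define n where "n = measure M (ball x (\<Lambda> * \<tau> * R))"
    have "measure M (ball x R) \<le> n"
      unfolding n_def using C R \<open>1 < \<tau>\<close> mult_mono[of 1 "\<Lambda> * \<tau>" R R]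
      by (intro measure_ball_mono[OF M]) (auto simp: mult_ge1_I)
    moreover have "0 < measure M (ball x R)" using bm R by blast
    ultimately have n: "0 < n" "measure M (ball x R) \<le> n" by auto
    have "ennreal (\<beta> * measure M ?D) \<le> emeasure M (ball x r)"
    proof -
      have "\<beta> * measure M ?D \<le> \<delta> * measure M ?D" by (intro mult_right_mono) (auto simp: \<beta>_def)
      also have "\<dots> \<le> measure M (ball x (1 / (2 * \<tau>) * (\<tau> * R)))" by (rule \<delta>(2)) fact
      also have "\<dots> \<le> measure M (ball x r)"
        using R \<open>1 < \<tau>\<close> by (intro measure_ball_mono[OF M]) auto
      finally show ?thesis by (simp add: bm ennreal_leI)
    qed
    moreover have "ennreal (\<beta> * measure M ?D) \<le> emeasure M (?D - ball x R)"
    proof -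
      have "\<beta> * measure M ?D \<le> (1 - 1 / \<gamma>) * measure M ?D"
        by (intro mult_right_mono) (auto simp: \<beta>_def)
      also have "\<dots> \<le> measure M ?D - measure M (ball x R)"
        using \<gamma>(2)[OF R(1,4)] \<gamma>(1) by (simp add: field_simps)
      also have "\<dots> = measure M (?D - ball x R)"
        using measure_annulus[OF M, of R "\<tau> * R" x] \<open>R < \<tau> * R\<close> by simp
      finally have "ennreal (\<beta> * measure M ?D) \<le> ennreal (measure M (?D - ball x R))"
        by (rule ennreal_leI)
      then show ?thesis
        using bm(4)[of x "\<tau> * R"] emeasure_mono[of "?D - ball x R" ?D M] bm(1)
        by (subst emeasure_eq_ennreal_measure) (auto simp: top_unique)
    qed
    moreover have "ball x r \<subseteq> ?D" using \<open>r < R\<close> \<open>R < \<tau> * R\<close> by (intro subset_ball) linarith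
    ultimately have "ennreal (\<beta> * measure M ?D) \<le> (\<integral>\<^sup>+ y\<in>?D. ennreal \<bar>w y - m\<bar> \<partial>M)"
      using R w bm(1) \<open>R < \<tau> * R\<close>
      by (intro set_nn_integral_deviation_ge[of "ball x r" M "?D - ball x R"]) auto
    then have "ennreal (\<beta> * measure M ?D) / emeasure M ?D \<le>
        (\<integral>\<^sup>+ y\<in>?D. ennreal \<bar>w y - m\<bar> \<partial>M) / emeasure M ?D"
      by (rule divide_right_mono_ennreal)
    also have "ennreal (\<beta> * measure M ?D) / emeasure M ?D = ennreal \<beta>"
      using bm(3)[OF \<open>0 < \<tau> * R\<close>, of x] \<open>0 < \<beta>\<close> by (simp add: bm(2) divide_ennreal)
    also have "(\<integral>\<^sup>+ y\<in>?D. ennreal \<bar>w y - m\<bar> \<partial>M) / emeasure M ?D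
        \<le> ennreal (C * (\<tau> * R)) * epowr (I / ennreal n) (1 / q)"
    proof -
      \<comment> \<open>The Poincare inequality asks for an integrable function: \<open>w\<close> is
        at most 1 and vanishes outside a ball of finite measure.\<close>
      have "(\<integral>\<^sup>+ y. e2ennreal \<bar>ereal (w y)\<bar> \<partial>M) \<le> (\<integral>\<^sup>+ y. indicator (ball x R) y \<partial>M)"
        using w by (intro nn_integral_mono) (auto simp: indicator_def)
      also have "\<dots> < \<infinity>" using bm(1,4) by (simp add: less_top)
      finally show ?thesis
        using P[OF \<open>0 < \<tau> * R\<close> _ _ k] wM
        by (simp add: m_def I_def n_def bm(2) mult.assoc)
    qed
    finally have le: "ennreal \<beta> \<le> ennreal (C * (\<tau> * R)) * epowr (I / ennreal n) (1 / q)" .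
    have "ennreal ((\<beta> / (C * \<tau>)) powr q * measure M (ball x R) / R powr q) \<le> I"
    proof (cases I)
      case (real i)
      have "ennreal \<beta> \<le> ennreal (C * (\<tau> * R) * (i / n) powr (1 / q))"
        using le real n C R \<open>1 < \<tau>\<close> by (simp add: divide_ennreal epowr_ennreal ennreal_mult)
      then have "\<beta> / (C * \<tau> * R) \<le> (i / n) powr (1 / q)"
        using C R \<open>1 < \<tau>\<close> by (simp add: field_simps)
      then have "(\<beta> / (C * \<tau> * R)) powr q \<le> ((i / n) powr (1 / q)) powr q"
        using C R \<open>1 < \<tau>\<close> \<open>0 < \<beta>\<close> \<open>1 \<le> q\<close> by (intro powr_mono2) auto
      also have "\<dots> = i / n" using \<open>1 \<le> q\<close> real n by (simp add: powr_powr)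
      finally have "(\<beta> / (C * \<tau>)) powr q / R powr q * n \<le> i"
        using C R \<open>1 < \<tau>\<close> \<open>0 < \<beta>\<close> n
        by (simp add: powr_divide[symmetric] pos_le_divide_eq)
      moreover have "(\<beta> / (C * \<tau>)) powr q / R powr q * measure M (ball x R)
          \<le> (\<beta> / (C * \<tau>)) powr q / R powr q * n"
        using n by (intro mult_left_mono) auto
      ultimately show ?thesis using real by (simp add: ennreal_leI)
    qed simp
    then show "ennreal ((\<beta> / (C * \<tau>)) powr q * measure M (ball x R) / R powr q)
        \<le> (\<integral>\<^sup>+ y\<in>ball x (\<Lambda> * \<tau> * R). epowr (k y) q \<partial>M)"
      unfolding I_def .
  qed
qed

text \<open>Here \<open>d\<close> stands for \<open>1 - r / R\<close> and \<open>i\<close> for the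
  \<open>p\<close>-energy. The level \<open>t\<close> is chosen so that the first term on the right
  is exactly half of the left side; the other half is then bounded by the term with
  \<open>i\<close>.\<close>

lemma optimize_truncation:
  fixes K C d R \<mu> p q \<eta> i :: real
  assumes pos: "0 < K" "0 < C" "0 < d" "0 < R" "0 < q"
    and le: "\<And>t. 0 < t \<Longrightarrow> K * \<mu> / R powr q
              \<le> 2 powr q * (t powr q * (C * d powr \<eta> * \<mu>) + t powr (q - p) * i)"
  shows "K / (2 * 2 powr q) * (K / (2 * 2 powr q * C)) powr ((p - q) / q) * d powr (\<eta> * (q - p) / q)
       * (\<mu> / R powr p) \<le> i"
proof -
  \<comment> \<open>Determined by \<open>2 powr q * L * C = K / 2\<close>; the next definition
    amounts to \<open>t powr q = L / (R powr q * d powr \<eta>)\<close>.\<close>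
  define L where "L = K / (2 * 2 powr q * C)"
  define t where "t = L powr (1 / q) / (R * d powr (\<eta> / q))"
  have "0 < L" "0 < t" using pos by (auto simp: L_def t_def)
  have tq: "t powr q = L / (R powr q * d powr \<eta>)"
    using pos \<open>0 < L\<close> by (simp add: t_def powr_divide powr_mult powr_powr)
  have "K * \<mu> / R powr q \<le> 2 powr q * (L * C * \<mu> / R powr q) + 2 powr q * t powr (q - p) * i"
    using le[OF \<open>0 < t\<close>] pos by (simp add: tq distrib_left mult_ac)
  also have "2 powr q * (L * C * \<mu> / R powr q) = K * \<mu> / R powr q / 2"
    using pos by (simp add: L_def)
  finally have "K * \<mu> / R powr q \<le> t powr (q - p) * i * (2 * 2 powr q)" by argo
  then have "K * \<mu> / R powr q / (2 * 2 powr q) \<le> t powr (q - p) * i"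
    by (subst pos_divide_le_eq) auto
  then have "t powr (p - q) * (K * \<mu> / R powr q / (2 * 2 powr q)) \<le> t powr (p - q) * (t powr (q - p) * i)"
    by (intro mult_left_mono) auto
  also have "\<dots> = i" using \<open>0 < t\<close> by (simp add: mult.assoc[symmetric] powr_add[symmetric])
  finally have "t powr (p - q) * (K * \<mu> / R powr q / (2 * 2 powr q)) \<le> i" .
  moreover have "t powr (p - q) = L powr ((p - q) / q) * R powr (q - p) * d powr (\<eta> * (q - p) / q)"
  proof -
    have "t powr (p - q) = L powr ((p - q) / q) / (R powr (p - q) * d powr (\<eta> * (p - q) / q))"
      using pos \<open>0 < L\<close> by (simp add: t_def powr_divide powr_mult powr_powr)
    moreover have "R powr (q - p) = 1 / R powr (p - q)"
      using powr_minus_divide[of R "p - q"] by simp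
    moreover have "\<eta> * (q - p) / q = - (\<eta> * (p - q) / q)" using pos by (simp add: field_simps)
    then have "d powr (\<eta> * (q - p) / q) = 1 / d powr (\<eta> * (p - q) / q)"
      by (metis powr_minus_divide)
    ultimately show ?thesis by simp
  qed
  moreover have "1 / R powr p = R powr (q - p) / R powr q"
    using pos by (simp flip: powr_diff powr_minus_divide)
  then have "\<mu> / R powr p = \<mu> * (R powr (q - p) / R powr q)" by (metis mult.right_neutral times_divide_eq_right)
  ultimately show ?thesis unfolding L_def[symmetric] by (simp add: mult_ac)
qed

section \<open>The capacity estimate\<close>

lemma set_nn_integral_epowr_le_truncation:
  assumes g: "g \<in> borel_measurable M" and W: "W \<in> sets M" and t: "0 < t" "0 \<le> q" "q \<le> p"
  shows "(\<integral>\<^sup>+ y\<in>W. epowr (g y) q \<partial>M)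
       \<le> ennreal (t powr q) * emeasure M W + ennreal (t powr (q - p)) * (\<integral>\<^sup>+ y\<in>W. epowr (g y) p \<partial>M)"
proof -
  note [measurable] = g W
  have "(\<integral>\<^sup>+ y\<in>W. epowr (g y) q \<partial>M) \<le> (\<integral>\<^sup>+ y. ennreal (t powr q) * indicator W y
      + ennreal (t powr (q - p)) * (epowr (g y) p * indicator W y) \<partial>M)"
    using epowr_le_truncation[OF t] by (intro nn_integral_mono) (auto simp: indicator_def)
  also have "\<dots> = ennreal (t powr q) * emeasure M W
      + ennreal (t powr (q - p)) * (\<integral>\<^sup>+ y\<in>W. epowr (g y) p \<partial>M)"
    by (subst nn_integral_add) (auto simp: nn_integral_cmult nn_integral_cmult_indicator)
  finally show ?thesis .
qed

lemma nn_integral_epowr_add_finite: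
  assumes [measurable]: "g \<in> borel_measurable M" "h \<in> borel_measurable M" and "0 \<le> p"
    and "(\<integral>\<^sup>+ y. epowr (g y) p \<partial>M) < \<infinity>" "(\<integral>\<^sup>+ y. epowr (h y) p \<partial>M) < \<infinity>"
  shows "(\<integral>\<^sup>+ y. epowr (g y + h y) p \<partial>M) < \<infinity>"
proof -
  have "(\<integral>\<^sup>+ y. epowr (g y + h y) p \<partial>M) \<le> (\<integral>\<^sup>+ y. ennreal (2 powr p) * (epowr (g y) p + epowr (h y) p) \<partial>M)"
    using \<open>0 \<le> p\<close> by (intro nn_integral_mono epowr_add_le)
  also have "\<dots> = ennreal (2 powr p) * ((\<integral>\<^sup>+ y. epowr (g y) p \<partial>M) + (\<integral>\<^sup>+ y. epowr (h y) p \<partial>M))"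
    by (subst nn_integral_cmult) (auto simp: nn_integral_add)
  also have "\<dots> < \<infinity>" using assms by (simp add: ennreal_mult_less_top)
  finally show ?thesis .
qed

text \<open>The main term is counted over \<open>W\<close> alone, while the perturbation is counted
  over all of \<open>B\<close> but with a factor that vanishes as \<open>\<epsilon>\<close> tends to
  0.\<close>

lemma set_nn_integral_epowr_perturbation:
  assumes g [measurable]: "g \<in> borel_measurable M" and \<sigma> [measurable]: "\<sigma> \<in> borel_measurable M"
    and W [measurable]: "W \<in> sets M" "B \<in> sets M" and "0 < q" "0 < \<epsilon>"
  shows "(\<integral>\<^sup>+ y\<in>B. epowr (g y * indicator W y + ennreal \<epsilon> * \<sigma> y) q \<partial>M)
     \<le> ennreal (2 powr q) * ((\<integral>\<^sup>+ y\<in>W. epowr (g y) q \<partial>M)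
          + ennreal (\<epsilon> powr q) * (\<integral>\<^sup>+ y\<in>B. epowr (\<sigma> y) q \<partial>M))"
proof -
  have "(\<integral>\<^sup>+ y\<in>B. epowr (g y * indicator W y + ennreal \<epsilon> * \<sigma> y) q \<partial>M)
     \<le> (\<integral>\<^sup>+ y. ennreal (2 powr q) * (epowr (g y) q * indicator W y
          + ennreal (\<epsilon> powr q) * (epowr (\<sigma> y) q * indicator B y)) \<partial>M)"
  proof (rule nn_integral_mono)
    fix y
    have "epowr (g y * indicator W y + ennreal \<epsilon> * \<sigma> y) q
        \<le> ennreal (2 powr q) * (epowr (g y) q * indicator W y + ennreal (\<epsilon> powr q) * epowr (\<sigma> y) q)"
      using epowr_add_le[of q "g y * indicator W y" "ennreal \<epsilon> * \<sigma> y"] assms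
      by (auto simp: epowr_cmult indicator_def epowr_def[of 0] split: if_splits)
    then show "epowr (g y * indicator W y + ennreal \<epsilon> * \<sigma> y) q * indicator B y
        \<le> ennreal (2 powr q) * (epowr (g y) q * indicator W y
          + ennreal (\<epsilon> powr q) * (epowr (\<sigma> y) q * indicator B y))"
      by (auto simp: indicator_def)
  qed
  also have "\<dots> = ennreal (2 powr q) * ((\<integral>\<^sup>+ y\<in>W. epowr (g y) q \<partial>M)
          + ennreal (\<epsilon> powr q) * (\<integral>\<^sup>+ y\<in>B. epowr (\<sigma> y) q \<partial>M))"
    by (simp add: nn_integral_cmult nn_integral_add)
  finally show ?thesis .
qed

lemma le_of_le_add_powr_mult:
  fixes a b s q :: real
  assumes "0 < q" "\<And>\<epsilon>. 0 < \<epsilon> \<Longrightarrow> a \<le> b + \<epsilon> powr q * s"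
  shows "a \<le> b"
proof -
  have "((\<lambda>\<epsilon>. \<epsilon> powr q) \<longlongrightarrow> 0) (at_right 0)"
  proof -
    have "((\<lambda>\<epsilon>. \<epsilon> powr q) \<longlongrightarrow> 0 powr q) (at_right (0::real))"
      using \<open>0 < q\<close> by (intro tendsto_powr2 tendsto_intros) (auto simp: eventually_at_right_less intro: eventually_at_rightI[of 0 1])
    then show ?thesis by simp
  qed
  then have "((\<lambda>\<epsilon>. b + \<epsilon> powr q * s) \<longlongrightarrow> b + 0 * s) (at_right 0)"
    by (intro tendsto_intros)
  then have "((\<lambda>\<epsilon>. b + \<epsilon> powr q * s) \<longlongrightarrow> b) (at_right 0)" by simp
  then show ?thesis
    by (rule tendsto_lowerbound) (auto intro!: eventually_at_rightI[of 0 1] assms)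
qed

text \<open>Let \<open>G\<close> and \<open>P\<close> be Borel majorants of \<open>g\<close> and of
  the function \<open>\<rho>\<close> witnessing the exceptional family, and
  \<open>\<sigma> = G + P\<close>. A finite integral of \<open>\<sigma>\<close> along a curve forces
  a finite integral of \<open>\<rho>\<close>, so the curve is not exceptional, and passing from
  \<open>g\<close> to \<open>G\<close> only enlarges the right-hand side.\<close>

lemma weak_upper_gradient_borel_majorants:
  fixes M :: "'a::metric_space measure" and w :: "'a \<Rightarrow> real"
  assumes M: "metric_measure_space M" and "0 \<le> p"
    and g: "g \<in> Lp_nonneg M p" and wug: "weak_upper_gradient M p (\<lambda>x. ereal (w x)) g"
  obtains G \<sigma> where "G \<in> borel_measurable borel" "\<sigma> \<in> borel_measurable borel"
    "AE x in M. g x = G x" "\<And>x. G x \<le> \<sigma> x" "(\<integral>\<^sup>+ x. epowr (\<sigma> x) p \<partial>M) < \<infinity>"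
    "\<And>l \<gamma>. arclength_curve l \<gamma> \<Longrightarrow> line_integral l \<gamma> \<sigma> < \<infinity> \<Longrightarrow>
       ennreal (dist (w (\<gamma> 0)) (w (\<gamma> l))) \<le> line_integral l \<gamma> G"
proof -
  obtain N where N: "sets N = sets borel" "M = completion N"
    using M unfolding metric_measure_space_def by blast
  then have meas: "f \<in> borel_measurable N \<longleftrightarrow> f \<in> borel_measurable borel" for f :: "'a \<Rightarrow> ennreal"
    by (simp cong: measurable_cong_sets)
  have measM: "f \<in> borel_measurable M" if "f \<in> borel_measurable borel" for f :: "'a \<Rightarrow> ennreal"
    using that meas N by (auto intro: measurable_completion)
  obtain \<rho> where \<rho>: "\<rho> \<in> Lp_nonneg M p" and ex: "\<And>l \<gamma>. arclength_curve l \<gamma> \<Longrightarrow>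
      line_integral l \<gamma> \<rho> \<noteq> \<infinity> \<Longrightarrow>
      endpoint_diff (ereal (w (\<gamma> 0))) (ereal (w (\<gamma> l))) \<le> line_integral l \<gamma> g"
    using wug unfolding weak_upper_gradient_def p_almost_every_curve_def by blast
  obtain G where G: "G \<in> borel_measurable N" "\<And>x. g x \<le> G x" "AE x in M. g x = G x"
    using borel_measurable_completion_majorant[of g N] g[unfolded Lp_nonneg_def] N by blast
  obtain P where P: "P \<in> borel_measurable N" "\<And>x. \<rho> x \<le> P x" "AE x in M. \<rho> x = P x"
    using borel_measurable_completion_majorant[of \<rho> N] \<rho>[unfolded Lp_nonneg_def] N by blast
  note [measurable] = G(1)[unfolded meas] P(1)[unfolded meas]
  have li_mono: "line_integral l \<gamma> f \<le> line_integral l \<gamma> h"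
    if "\<And>x. f x \<le> h x" for l f h and \<gamma> :: "real \<Rightarrow> 'a"
    unfolding line_integral_def using that by (intro nn_integral_mono mult_right_mono) auto
  show ?thesis
  proof
    show "G \<in> borel_measurable borel" by measurable
    show "(\<lambda>x. G x + P x) \<in> borel_measurable borel" by measurable
    show "AE x in M. g x = G x" by fact
    show "G x \<le> G x + P x" for x by simp
    have "(\<integral>\<^sup>+ x. epowr (G x) p \<partial>M) = (\<integral>\<^sup>+ x. epowr (g x) p \<partial>M)"
      using G(3) by (intro nn_integral_cong_AE) auto
    moreover have "(\<integral>\<^sup>+ x. epowr (P x) p \<partial>M) = (\<integral>\<^sup>+ x. epowr (\<rho> x) p \<partial>M)"
      using P(3) by (intro nn_integral_cong_AE) auto
    ultimately show "(\<integral>\<^sup>+ x. epowr (G x + P x) p \<partial>M) < \<infinity>"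
      using g \<rho> \<open>0 \<le> p\<close> by (intro nn_integral_epowr_add_finite measM) (auto simp: Lp_nonneg_def)
    fix l and \<gamma> :: "real \<Rightarrow> 'a"
    assume \<gamma>: "arclength_curve l \<gamma>" and fin: "line_integral l \<gamma> (\<lambda>x. G x + P x) < \<infinity>"
    have "line_integral l \<gamma> \<rho> \<le> line_integral l \<gamma> (\<lambda>x. G x + P x)"
      using P(2) by (intro li_mono) (simp add: add_increasing)
    then have "endpoint_diff (ereal (w (\<gamma> 0))) (ereal (w (\<gamma> l))) \<le> line_integral l \<gamma> g"
      using fin by (intro ex[OF \<gamma>]) auto
    also have "\<dots> \<le> line_integral l \<gamma> G" using G(2) by (rule li_mono)
    finally show "ennreal (dist (w (\<gamma> 0)) (w (\<gamma> l))) \<le> line_integral l \<gamma> G"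
      by (simp add: endpoint_diff_def dist_real_def)
  qed
qed

section \<open>From the energy bound to the capacity\<close>

theorem theorem4p1:
  fixes M :: "'a::metric_space measure" and x0 :: 'a and p q \<eta> \<tau> :: real
  assumes "metric_measure_space M"
    and "1 \<le> q" and "q < p"
    and "poincare_at M q x0"
    and "0 < \<eta>" and "annular_decay_at M \<eta> x0"
    and "1 < \<tau>" and "reverse_doubling_at M \<tau> x0"
  shows "\<exists>c::real. 0 < c \<and>
    (\<forall>r R. 0 < R / 2 \<and> R / 2 \<le> r \<and> r < R \<and>
       ennreal R \<le> ediameter (UNIV :: 'a set) / ennreal (2 * \<tau>) \<longrightarrow>
       variational_capacity M p (ball x0 r) (ball x0 R)
         \<ge> ennreal (c * (1 - r / R) powr (\<eta> * (q - p) / q) * (measure M (ball x0 R) / R powr p)))"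
proof -
  note M = assms(1)
  obtain K \<Lambda> where K: "0 < K" "1 \<le> \<Lambda>" and energy:
    "\<And>r R w k. \<lbrakk>0 < R; R / 2 \<le> r; r < R; ennreal R \<le> ediameter (UNIV :: 'a set) / ennreal (2 * \<tau>);
       w \<in> borel_measurable M; \<forall>y. 0 \<le> w y \<and> w y \<le> 1; \<forall>y\<in>ball x0 r. w y = 1;
       \<forall>y\<in>-ball x0 R. w y = 0; upper_gradient (\<lambda>y. ereal (w y)) k\<rbrakk> \<Longrightarrow>
       ennreal (K * measure M (ball x0 R) / R powr q) \<le> (\<integral>\<^sup>+ y\<in>ball x0 (\<Lambda> * R). epowr (k y) q \<partial>M)"
    using poincare_energy_lower_bound[OF M assms(2,4-8)] by blast
  obtain C where C: "1 \<le> C" "\<And>r R. 0 < r \<Longrightarrow> r < R \<Longrightarrow>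
       measure M (ball x0 R - ball x0 r) \<le> C * (1 - r / R) powr \<eta> * measure M (ball x0 R)"
    using annular_decay_atE[OF assms(6)] by blast
  \<comment> \<open>The factor produced by \<open>optimize_truncation\<close>; it involves only
    \<open>K\<close>, \<open>C\<close>, \<open>p\<close> and \<open>q\<close>, hence neither
    radius.\<close>
  define c where "c = K / (2 * 2 powr q) * (K / (2 * 2 powr q * C)) powr ((p - q) / q)"
  have "0 < c" using K C by (simp add: c_def)
  have pq: "0 < q" "0 < p" using assms by auto
  have borelM: "sets borel \<subseteq> sets M" "space M = UNIV"
    using metric_measure_space_sets[OF M] by auto
  have measM: "f \<in> borel_measurable M" if "f \<in> borel_measurable borel" for f :: "'a \<Rightarrow> ennreal"
    using that borelM by (auto simp: measurable_def)
  note bm = ball_measure[OF M]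
  have main: "ennreal (c * (1 - r / R) powr (\<eta> * (q - p) / q) * (measure M (ball x0 R) / R powr p))
      \<le> (\<integral>\<^sup>+ x\<in>ball x0 R. epowr (g x) p \<partial>M)"
    if R: "0 < R / 2" "R / 2 \<le> r" "r < R" "ennreal R \<le> ediameter (UNIV :: 'a set) / ennreal (2 * \<tau>)"
      and u: "u \<in> cap_admissible M p (ball x0 r) (ball x0 R)"
      and g: "minimal_weak_upper_gradient M p u g" for r R u g
  proof (cases "\<integral>\<^sup>+ x\<in>ball x0 R. epowr (g x) p \<partial>M")
    case (real i)
    define w where "w = (\<lambda>x. real_of_ereal (u x))"
    let ?\<mu> = "measure M (ball x0 R)"
    let ?W = "ball x0 R - ball x0 r" and ?B = "ball x0 (\<Lambda> * R)"
    have u01: "0 \<le> u x" "u x \<le> 1" for x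
    proof -
      have "0 \<le> u x \<and> u x \<le> 1"
      proof (cases "x \<in> ball x0 R")
        case True
        then have "indicator (ball x0 r) x \<le> u x \<and> u x \<le> 1"
          using u unfolding cap_admissible_def by blast
        moreover have "(0::ereal) \<le> indicator (ball x0 r) x" by (simp add: indicator_def)
        ultimately show ?thesis by (auto intro: order_trans)
      next
        case False
        then have "u x = 0" using u unfolding cap_admissible_def by blast
        then show ?thesis by simp
      qed
      then show "0 \<le> u x" "u x \<le> 1" by auto
    qed
    \<comment> \<open>Values in \<open>[0, 1]\<close> everywhere make \<open>u\<close> real-valued,
      so the curve lemmas for real functions apply.\<close>
    have uw: "u x = ereal (w x)" for x
      using u01[of x] by (cases "u x") (auto simp: w_def)
    have w01: "0 \<le> w x" "w x \<le> 1" for x using u01[of x] by (auto simp: uw)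
    have w1: "w x = 1" if "x \<in> ball x0 r" for x
    proof -
      have "x \<in> ball x0 R" using that R by auto
      then have "indicator (ball x0 r) x \<le> u x" using u unfolding cap_admissible_def by blast
      then have "1 \<le> u x" using that by (simp add: indicator_def)
      then show ?thesis using w01[of x] by (simp add: uw)
    qed
    have w0: "w x = 0" if "x \<notin> ball x0 R" for x
      using u that by (simp add: cap_admissible_def w_def)
    have wM: "w \<in> borel_measurable M"
      using u unfolding w_def cap_admissible_def newtonian_space_def
      by (auto intro: borel_measurable_real_of_ereal)
    have gL: "g \<in> Lp_nonneg M p" "weak_upper_gradient M p (\<lambda>x. ereal (w x)) g"
      using g by (auto simp: minimal_weak_upper_gradient_def simp flip: uw)
    obtain G \<sigma> where G: "G \<in> borel_measurable borel" "\<sigma> \<in> borel_measurable borel"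
      "AE x in M. g x = G x" "\<And>x. G x \<le> \<sigma> x" "(\<integral>\<^sup>+ x. epowr (\<sigma> x) p \<partial>M) < \<infinity>"
      "\<And>l \<gamma>. arclength_curve l \<gamma> \<Longrightarrow> line_integral l \<gamma> \<sigma> < \<infinity> \<Longrightarrow>
        ennreal (dist (w (\<gamma> 0)) (w (\<gamma> l))) \<le> line_integral l \<gamma> G"
      using weak_upper_gradient_borel_majorants[OF M less_imp_le[OF pq(2)] gL] by blast
    have sets: "?W \<in> sets M" "?B \<in> sets M" using bm by auto
    \<comment> \<open>Truncation at level 1 turns the finite \<open>p\<close>-energy of
      \<open>\<sigma>\<close> into a finite \<open>q\<close>-energy on the ball
      \<open>?B\<close>.\<close>
    have "(\<integral>\<^sup>+ y\<in>?B. epowr (\<sigma> y) q \<partial>M)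
        \<le> ennreal (1 powr q) * emeasure M ?B + ennreal (1 powr (q - p)) * (\<integral>\<^sup>+ y\<in>?B. epowr (\<sigma> y) p \<partial>M)"
      using pq assms G(2) sets by (intro set_nn_integral_epowr_le_truncation measM) auto
    also have "(\<integral>\<^sup>+ y\<in>?B. epowr (\<sigma> y) p \<partial>M) \<le> (\<integral>\<^sup>+ y. epowr (\<sigma> y) p \<partial>M)"
      by (intro nn_integral_mono) (auto simp: indicator_def)
    finally have "(\<integral>\<^sup>+ y\<in>?B. epowr (\<sigma> y) q \<partial>M)
        \<le> emeasure M ?B + (\<integral>\<^sup>+ y. epowr (\<sigma> y) p \<partial>M)"
      by (simp add: add_left_mono)
    also have "\<dots> < \<infinity>" using G(5) bm(4)[of x0 "\<Lambda> * R"] by (simp add: less_top[symmetric])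
    finally have "(\<integral>\<^sup>+ y\<in>?B. epowr (\<sigma> y) q \<partial>M) < \<infinity>" .
    then obtain s where s: "0 \<le> s" "(\<integral>\<^sup>+ y\<in>?B. epowr (\<sigma> y) q \<partial>M) = ennreal s"
      by (cases "\<integral>\<^sup>+ y\<in>?B. epowr (\<sigma> y) q \<partial>M") auto
    have Gp: "(\<integral>\<^sup>+ y\<in>?W. epowr (G y) p \<partial>M) \<le> ennreal i"
    proof -
      have "(\<integral>\<^sup>+ y\<in>?W. epowr (G y) p \<partial>M) \<le> (\<integral>\<^sup>+ y\<in>ball x0 R. epowr (G y) p \<partial>M)"
        by (intro nn_integral_mono) (auto simp: indicator_def)
      also have "\<dots> = (\<integral>\<^sup>+ y\<in>ball x0 R. epowr (g y) p \<partial>M)"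
        using G(3) by (intro nn_integral_cong_AE) auto
      finally show ?thesis using real by simp
    qed
    have W: "emeasure M ?W \<le> ennreal (C * (1 - r / R) powr \<eta> * ?\<mu>)"
    proof -
      have "emeasure M ?W = ennreal (measure M ?W)"
        using bm(4)[of x0 R] emeasure_mono[of ?W "ball x0 R" M] bm(1)
        by (subst emeasure_eq_ennreal_measure) (auto simp: top_unique)
      then show ?thesis using C(2)[of r R] R by (simp add: ennreal_leI)
    qed
    \<comment> \<open>For fixed \<open>t\<close> the perturbation is sent to 0 first;
      \<open>G\<close>, \<open>\<sigma>\<close> and the finite number \<open>s\<close> do not depend
      on \<open>\<epsilon>\<close>.\<close>
    have "K * ?\<mu> / R powr q \<le> 2 powr q * (t powr q * (C * (1 - r / R) powr \<eta> * ?\<mu>) + t powr (q - p) * i)"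
      if "0 < t" for t
    proof (rule le_of_le_add_powr_mult[OF \<open>0 < q\<close>, where s = "2 powr q * s"])
      fix \<epsilon> :: real assume "0 < \<epsilon>"
      \<comment> \<open>The level sets are \<open>ball x0 r\<close>, with value 1, and the
        complement of \<open>ball x0 R\<close>, with value 0. What remains is exactly the annulus
        \<open>?W\<close>.\<close>
      have ug: "upper_gradient (\<lambda>x. ereal (w x))
          (\<lambda>x. G x * indicator (- (ball x0 r \<union> - ball x0 R)) x + ennreal \<epsilon> * \<sigma> x)"
        using G w1 w0 \<open>0 < \<epsilon>\<close>
        by (intro upper_gradient_off_level_sets[where c = 1 and d = 0]) (auto simp del: mem_ball)
      have "- (ball x0 r \<union> - ball x0 R) = ?W" by auto
      then have "ennreal (K * ?\<mu> / R powr q)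
          \<le> (\<integral>\<^sup>+ y\<in>?B. epowr (G y * indicator ?W y + ennreal \<epsilon> * \<sigma> y) q \<partial>M)"
        using energy[of R r w, OF _ R(2-4) wM _ _ _ ug] R(1) w01 w1 w0 by simp
      also have "\<dots> \<le> ennreal (2 powr q) * ((\<integral>\<^sup>+ y\<in>?W. epowr (G y) q \<partial>M) + ennreal (\<epsilon> powr q) * ennreal s)"
        unfolding s(2)[symmetric]
        using G pq sets \<open>0 < \<epsilon>\<close> by (intro set_nn_integral_epowr_perturbation measM) auto
      also have "(\<integral>\<^sup>+ y\<in>?W. epowr (G y) q \<partial>M)
          \<le> ennreal (t powr q) * emeasure M ?W + ennreal (t powr (q - p)) * (\<integral>\<^sup>+ y\<in>?W. epowr (G y) p \<partial>M)"
        using G pq assms sets \<open>0 < t\<close> by (intro set_nn_integral_epowr_le_truncation measM) auto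
      also have "\<dots> \<le> ennreal (t powr q) * ennreal (C * (1 - r / R) powr \<eta> * ?\<mu>)
          + ennreal (t powr (q - p)) * ennreal i"
        using Gp W by (intro add_mono mult_left_mono) auto
      finally have "ennreal (K * ?\<mu> / R powr q) \<le> ennreal (2 powr q *
          (t powr q * (C * (1 - r / R) powr \<eta> * ?\<mu>) + t powr (q - p) * i + \<epsilon> powr q * s))"
        using C(1) real s(1) by (simp add: mult_left_mono add_mono flip: ennreal_mult ennreal_plus)
      then have "K * ?\<mu> / R powr q \<le> 2 powr q *
          (t powr q * (C * (1 - r / R) powr \<eta> * ?\<mu>) + t powr (q - p) * i + \<epsilon> powr q * s)"
        using C(1) real s(1) by (subst (asm) ennreal_le_iff) auto
      then show "K * ?\<mu> / R powr q \<le> 2 powr q *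
          (t powr q * (C * (1 - r / R) powr \<eta> * ?\<mu>) + t powr (q - p) * i) + \<epsilon> powr q * (2 powr q * s)"
        by (simp add: algebra_simps)
    qed
    \<comment> \<open>The inequality now holds for all \<open>t > 0\<close>, and
      \<open>optimize_truncation\<close> is applied with \<open>d = 1 - r / R\<close>.\<close>
    then have "c * (1 - r / R) powr (\<eta> * (q - p) / q) * (?\<mu> / R powr p) \<le> i"
      unfolding c_def using K C R pq by (intro optimize_truncation) auto
    then show ?thesis using real by (simp add: ennreal_leI)
  qed simp
  \<comment> \<open>Every admissible pair satisfies the bound, hence so does the infimum, which is
    \<infinity> if there is no such pair.\<close>
  show ?thesis
    using \<open>0 < c\<close> main unfolding variational_capacity_def
    by (intro exI[of _ c] conjI allI impI INF_greatest) auto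
qed

end
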